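(* Let $\varphi_1$ be a Jacob's ladder, let $k_0\in\mathbb{N}$ be fixed, let $1\le k\le k_0$, and let $\Delta\in\mathbb{R}$, $\Delta\ne0$, be fixed. For each $L\in\mathbb{N}$ let $a_L\in(0,\frac12]$. Then there is $\bar L_0>0$ such that for all $L\in\mathbb{N}$ with $L>\bar L_0$ and all $U\in(0,a_L)$ the $\mathcal{Z}_{\zeta,Q^2}$-transformation of the signal $f(t)=t^\Delta$, $t\in[L,L+U]$, is the constant $1$ (the telegraphic, i.e. unit rectangular, signal). That is, for all points $\alpha_0,\alpha_1,\dots,\alpha_k$ associated with $(L,U,k;f)$ and all points $\beta_1,\dots,\beta_k$ associated with $(L,U,k)$ (so that $\alpha_0\in(L,L+U)$) one has $$\prod_{r=1}^k\left|\frac{\zeta\left(\frac12+i\alpha_r\right)}{\zeta\left(\frac12+i\beta_r\right)}\right|^2=1+\mathcal{O}\left(\frac{\ln\ln L}{\ln L}\right),\qquad L\to\infty,$$ uniformly in $U\in(0,a_L)$, where the implied constant may depend on $\Delta$, $k_0$ and $\varphi_1$.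
   Context: $\zeta$ is the Riemann zeta-function and $Z(t)=e^{i\vartheta(t)}\zeta(\frac12+it)$ is Hardy's function, so $|Z(t)|=|\zeta(\frac12+it)|$. Jacob's ladder. Let $\mu$ be an admissible function: $\mu\in C^\infty([y_0,\infty))$ is increasing, unbounded, and $\mu(y)\ge 7y\ln y$. Let $y=\varphi(T)=\varphi(T;\mu)$ be the solution $x(T)=\varphi(T)$ of the nonlinear integral equation $$\int_0^{\mu[x(T)]}Z^2(t)e^{-\frac{2}{x(T)}t}\,dt=\int_0^TZ^2(t)\,dt .$$ The Jacob's ladder is $\varphi_1(t)=\frac12\varphi(t)$. For large $t$ it is a continuously differentiable strictly increasing function tending to infinity, with $t-\varphi_1(t)\sim(1-c)\frac{t}{\ln t}$ ($c$ is Euler's constant). Its derivative is denoted $\tilde Z^2(t)=\frac{d\varphi_1(t)}{dt}$ and satisfies $$\tilde Z^2(t)=\frac{|\zeta(\frac12+it)|^2}{\left\{1+\mathcal{O}\left(\frac{\ln\ln t}{\ln t}\right)\right\}\ln t},\qquad t\to\infty .$$ These are known properties of $\varphi_1$. Iterates. $\varphi_1^0(t)=t$, $\varphi_1^r=\varphi_1\circ\varphi_1^{r-1}$. For large $T$ and $r=0,1,\dots,k_0$, the reverse iterates are $\overset{r}{T}=\varphi_1^{-r}(T)$, i.e. $\overset{0}{T}=T$ and $\varphi_1(\overset{r}{T})=\overset{r-1}{T}$; similarly $(T+U)^{[r]}:=\varphi_1^{-r}(T+U)$. Associated points. Let $f$ be continuous on $[T,T+U]$, $U>0$. By the change of variables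 $t\mapsto\varphi_1^k(t)$ and the mean-value theorem there is $d\in(\overset{k}{T},(T+U)^{[k]})$ with $$\int_T^{T+U}f(t)\,dt=\int_{\overset{k}{T}}^{(T+U)^{[k]}}f[\varphi_1^k(t)]\prod_{r=0}^{k-1}\tilde Z^2[\varphi_1^r(t)]\,dt=\left((T+U)^{[k]}-\overset{k}{T}\right)f(\alpha_0)\prod_{r=1}^k\tilde Z^2(\alpha_r),$$ where $\alpha_r=\varphi_1^{k-r}(d)$, $r=0,1,\dots,k$. Any $\alpha_0,\dots,\alpha_k$ obtained from such a $d$ are called the points associated with $(T,U,k;f)$; one has $\alpha_0\in(T,T+U)$ and $\alpha_r\in(\overset{r}{T},(T+U)^{[r]})$. Points $\beta_1,\dots,\beta_k$ are associated with $(T,U,k)$ if they arise in the same way from $f\equiv1$: $\beta_r=\varphi_1^{k-r}(e)$, $r=1,\dots,k$, for some $e\in(\overset{k}{T},(T+U)^{[k]})$ with $U=\left((T+U)^{[k]}-\overset{k}{T}\right)\prod_{r=1}^k\tilde Z^2(\beta_r)$. In the claim these are used with $T=L$. The $\mathcal{Z}_{\zeta,Q^2}$-transformation. The $\mathcal{Z}_{\zeta,Q^2}$-transformation of $f(t)$, $t\in[T,T+U]$, $U\in(0,U_0)$, is said to be $g=g[T,U,\alpha_0(T,U,k;f)]$, $U\in(0,U_0)$, $\alpha_0\in(T,T+U)$, if $$\prod_{r=1}^k\left|\frac{\zeta(\frac12+i\alpha_r)}{\zeta(\frac12+i\beta_r)}\right|^2=\left\{1+\mathcal{O}\left(\frac{\ln\ln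 T}{\ln T}\right)\right\}g,\qquad T\to\infty .$$ *)

theory Defs
  imports "HOL-Complex_Analysis.Complex_Analysis" "HOL-Library.Landau_Symbols"
begin

unbundle asymp_equiv_syntax

(* The analytic continuation of the Dirichlet series to the punctured plane. By the identity
   theorem it is unique there; only the irrelevant value at 1 is left unspecified. *)
definition riemann_zeta :: "complex \<Rightarrow> complex" where
  "riemann_zeta = (SOME f. f holomorphic_on (- {1}) \<and>
     (\<forall>s. Re s > 1 \<longrightarrow> (\<lambda>n. 1 / (of_nat (Suc n) powr s)) sums f s))"

definition zeta_crit :: "real \<Rightarrow> complex" where
  "zeta_crit t = riemann_zeta (1 / 2 + \<i> * of_real t)"

(* On the right half-plane ln_Gamma is the holomorphic branch that is real on the positive axis. *)
definition riemann_siegel_theta :: "real \<Rightarrow> real" where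
  "riemann_siegel_theta t = Im (ln_Gamma (1 / 4 + \<i> * of_real (t / 2))) - t / 2 * ln pi"

(* The product is real by the functional equation of zeta, so taking Re loses nothing. *)
definition hardy_Z :: "real \<Rightarrow> real" where
  "hardy_Z t = Re (exp (\<i> * of_real (riemann_siegel_theta t)) * zeta_crit t)"

(* D n is the n-th derivative of mu on [y0, infinity), one-sided at the end point. *)
definition smooth_from :: "real \<Rightarrow> (real \<Rightarrow> real) \<Rightarrow> bool" where
  "smooth_from y0 \<mu> \<longleftrightarrow> (\<exists>D :: nat \<Rightarrow> real \<Rightarrow> real.
     (\<forall>y\<ge>y0. D 0 y = \<mu> y) \<and>
     (\<forall>n. \<forall>y\<ge>y0. (D n has_real_derivative D (Suc n) y) (at y within {y0..})))"

definition admissible :: "real \<Rightarrow> (real \<Rightarrow> real) \<Rightarrow> bool" where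
  "admissible y0 \<mu> \<longleftrightarrow>
     0 < y0 \<and> smooth_from y0 \<mu> \<and> mono_on {y0..} \<mu> \<and> \<not> bdd_above (\<mu> ` {y0..}) \<and>
     (\<forall>y\<ge>y0. \<mu> y \<ge> 7 * y * ln y)"

definition solves_ladder_equation :: "(real \<Rightarrow> real) \<Rightarrow> real \<Rightarrow> real \<Rightarrow> bool" where
  "solves_ladder_equation \<mu> x T \<longleftrightarrow>
     integral {0..\<mu> x} (\<lambda>t. (hardy_Z t)\<^sup>2 * exp (- (2 / x) * t))
       = integral {0..T} (\<lambda>t. (hardy_Z t)\<^sup>2)"

(* The ladder is a function of large T only: T0 is the left end point of its domain, and the
   values of the total function phi1 to the left of T0 are junk. *)
definition jacobs_ladder :: "real \<Rightarrow> (real \<Rightarrow> real) \<Rightarrow> real \<Rightarrow> (real \<Rightarrow> real) \<Rightarrow> bool" where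
  "jacobs_ladder y0 \<mu> T0 \<phi>1 \<longleftrightarrow> admissible y0 \<mu> \<and> 0 < T0 \<and>
     (\<exists>\<phi>. \<forall>T\<ge>T0. y0 \<le> \<phi> T \<and> solves_ladder_equation \<mu> (\<phi> T) T \<and> \<phi>1 T = \<phi> T / 2)"

definition Ztilde_sq :: "(real \<Rightarrow> real) \<Rightarrow> real \<Rightarrow> real" where
  "Ztilde_sq \<phi>1 = deriv \<phi>1"

definition reverse_iterate :: "real \<Rightarrow> (real \<Rightarrow> real) \<Rightarrow> nat \<Rightarrow> real \<Rightarrow> real" where
  "reverse_iterate T0 \<phi>1 r T = (inv_into {T0..} \<phi>1 ^^ r) T"

(* Only the values alpha 0, ..., alpha k matter. *)
definition associated_points ::
  "real \<Rightarrow> (real \<Rightarrow> real) \<Rightarrow> real \<Rightarrow> real \<Rightarrow> nat \<Rightarrow> (real \<Rightarrow> real) \<Rightarrow> (nat \<Rightarrow> real) \<Rightarrow> bool" where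
  "associated_points T0 \<phi>1 T U k f \<alpha> \<longleftrightarrow>
     (\<exists>d \<in> {reverse_iterate T0 \<phi>1 k T <..< reverse_iterate T0 \<phi>1 k (T + U)}.
        (\<forall>r\<in>{0..k}. \<alpha> r = (\<phi>1 ^^ (k - r)) d) \<and>
        integral {T..T + U} f =
          (reverse_iterate T0 \<phi>1 k (T + U) - reverse_iterate T0 \<phi>1 k T)
            * f (\<alpha> 0) * (\<Prod>r=1..k. Ztilde_sq \<phi>1 (\<alpha> r)))"

(* The case f = 1, without the point of index 0. *)
definition associated_points_unit ::
  "real \<Rightarrow> (real \<Rightarrow> real) \<Rightarrow> real \<Rightarrow> real \<Rightarrow> nat \<Rightarrow> (nat \<Rightarrow> real) \<Rightarrow> bool" where
  "associated_points_unit T0 \<phi>1 T U k \<beta> \<longleftrightarrow>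
     (\<exists>e \<in> {reverse_iterate T0 \<phi>1 k T <..< reverse_iterate T0 \<phi>1 k (T + U)}.
        (\<forall>r\<in>{1..k}. \<beta> r = (\<phi>1 ^^ (k - r)) e) \<and>
        U = (reverse_iterate T0 \<phi>1 k (T + U) - reverse_iterate T0 \<phi>1 k T)
              * (\<Prod>r=1..k. Ztilde_sq \<phi>1 (\<beta> r)))"

end

theory Submission imports Defs begin

text \<open>
  Write \<open>|\<zeta>(1/2 + it)|\<^sup>2 = \<phi>1'(t) G(t)\<close> with \<open>G(t) = (1 + \<epsilon>(t)) ln t\<close>, which is the known formula for
  the derivative of the ladder. The product over the \<open>\<alpha>\<^sub>r\<close> and \<open>\<beta>\<^sub>r\<close> then splits into two parts.

  The first part is the quotient of the two products of derivatives. Both mean-value identities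
  contain the same length of the \<open>k\<close>-th reverse interval, so this length cancels and the quotient
  equals the mean of \<open>t\<^sup>\<Delta>\<close> over \<open>[L, L + U]\<close> divided by \<open>\<alpha>\<^sub>0\<^sup>\<Delta>\<close>. On an interval of length at most
  \<open>1\<close> the function \<open>t\<^sup>\<Delta>\<close> varies only by a factor \<open>exp (O(1/L))\<close>
  (\<open>abs_ln_mean_powr_le\<close>), and this is the whole effect of the signal.

  The second part is the product of the quotients \<open>G(\<alpha>\<^sub>r) / G(\<beta>\<^sub>r)\<close>. The relation
  \<open>t - \<phi>1(t) \<sim> (1 - c) t / ln t\<close>, with \<open>c\<close> Euler's constant, gives \<open>\<phi>1(t) \<le> t \<le> 2 \<phi>1(t)\<close> for large \<open>t\<close>. Hence a reverse
  iteration at most doubles its argument (\<open>reverse_iterate_bounds\<close>), and all the points lie between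
  \<open>L\<close> and a fixed multiple of \<open>L\<close> (\<open>iterate_between_reverse_iterates\<close>). There \<open>ln ln t\<close> is constant up
  to \<open>O(1 / ln L)\<close> (\<open>abs_ln_ln_diff_le\<close>) and \<open>\<epsilon>(t)\<close> is \<open>O(ln ln L / ln L)\<close>.

  All the estimates are made for logarithms, where the boundedly many errors add up, and only the
  final one is exponentiated (\<open>abs_minus_one_le_of_abs_ln_le\<close>).
\<close>

section \<open>Multiplicative perturbation estimates\<close>

lemma abs_ln_one_plus_le:
  fixes x :: real
  assumes "\<bar>x\<bar> \<le> 1 / 2"
  shows "\<bar>ln (1 + x)\<bar> \<le> 2 * \<bar>x\<bar>"
proof -
  have "\<bar>ln (1 + x) - x\<bar> \<le> 2 * x\<^sup>2"
    by (rule abs_ln_one_plus_x_minus_x_bound[OF assms])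
  moreover have "2 * x\<^sup>2 \<le> \<bar>x\<bar>"
    using mult_right_mono[OF assms, of "\<bar>x\<bar>"] by (simp add: power2_eq_square)
  ultimately show ?thesis by linarith
qed

lemma abs_minus_one_le_of_abs_ln_le:
  fixes P q :: real
  assumes "P > 0" "\<bar>ln P\<bar> \<le> q" "q \<le> 1 / 2"
  shows "\<bar>P - 1\<bar> \<le> 2 * q"
proof -
  have P: "P = exp (ln P)" using assms by simp
  have "P \<le> exp q" "exp (- q) \<le> P"
    using assms by (subst P, subst exp_le_cancel_iff, linarith)+
  moreover have "exp q \<le> 1 + 2 * q"
    using assms by (intro real_exp_bound_lemma) auto
  moreover have "1 + (- q) \<le> exp (- q)" by (rule exp_ge_add_one_self)
  ultimately show ?thesis using assms by linarith
qed

lemma abs_ln_prod_le: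
  fixes u :: "'a \<Rightarrow> real" and c :: real
  assumes "finite A" "\<And>r. r \<in> A \<Longrightarrow> u r > 0" "\<And>r. r \<in> A \<Longrightarrow> \<bar>ln (u r)\<bar> \<le> c"
  shows "\<bar>ln (prod u A)\<bar> \<le> real (card A) * c"
proof -
  have "ln (prod u A) = (\<Sum>r\<in>A. ln (u r))"
    using assms(1) by (rule ln_prod) (use assms(2) in force)
  also have "\<bar>\<dots>\<bar> \<le> (\<Sum>r\<in>A. \<bar>ln (u r)\<bar>)" by (rule sum_abs)
  also have "\<dots> \<le> real (card A) * c" using assms(3) by (rule sum_bounded_above)
  finally show ?thesis .
qed

text \<open>
  This makes the factors \<open>ln t\<close> in the formula for the derivative of the ladder harmless:
  scaling \<open>t\<close> by a bounded factor adds a bounded amount to \<open>ln t\<close>, hence a relative change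
  \<open>O(1 / ln L)\<close>.
\<close>

lemma abs_ln_ln_diff_le:
  fixes x y L b :: real
  assumes "1 < L" "L \<le> x" "x \<le> b * L" "L \<le> y" "y \<le> b * L" "1 \<le> b"
  shows "\<bar>ln (ln x) - ln (ln y)\<bar> \<le> ln b / ln L"
proof -
  have *: "ln (ln z) - ln (ln L) \<in> {0..ln b / ln L}" if "L \<le> z" "z \<le> b * L" for z
  proof -
    have pos: "0 < ln L" and le: "ln L \<le> ln z" using assms that by auto
    have "ln z \<le> ln (b * L)" using assms that by (subst ln_le_cancel_iff) auto
    also have "\<dots> = ln b + ln L" using assms by (simp add: ln_mult)
    finally have z: "ln z - ln L \<le> ln b" by simp
    have "ln (ln z) - ln (ln L) = ln (1 + (ln z - ln L) / ln L)"
      using pos le by (subst ln_divide_pos[symmetric]) (auto simp: field_simps)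
    also have "\<dots> \<le> (ln z - ln L) / ln L"
      using pos le by (intro ln_add_one_self_le_self) auto
    also have "\<dots> \<le> ln b / ln L" using pos z by (intro divide_right_mono) auto
    finally show ?thesis using pos le by auto
  qed
  show ?thesis
    using *[of x] *[of y] assms unfolding atLeastAtMost_iff abs_le_iff by linarith
qed

text \<open>
  The logarithm of \<open>t powr \<Delta>\<close> has derivative \<open>\<Delta> / t\<close>, at most \<open>\<bar>\<Delta>\<bar> / L\<close> in absolute value, so the
  integrand stays within a factor \<open>exp (\<bar>\<Delta>\<bar> / L)\<close> of its value at any point of the short interval.
  Then its mean does so too, whatever the sign of \<open>\<Delta>\<close>.
\<close>

lemma abs_ln_mean_powr_le:
  fixes L U x \<Delta> :: real
  assumes "1 \<le> L" "0 < U" "U \<le> 1" "L \<le> x" "x \<le> L + U"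
  defines "I \<equiv> integral {L..L + U} (\<lambda>t. t powr \<Delta>)"
  shows "I > 0" "\<bar>ln (I / (U * x powr \<Delta>))\<bar> \<le> \<bar>\<Delta>\<bar> / L"
proof -
  define q where "q = \<bar>\<Delta>\<bar> / L"
  have bnd: "x powr \<Delta> * exp (- q) \<le> t powr \<Delta> \<and> t powr \<Delta> \<le> x powr \<Delta> * exp q"
    if t: "t \<in> {L..L + U}" for t
  proof -
    have *: "ln v - ln w \<le> 1 / L" if "L \<le> v" "v \<le> L + U" "L \<le> w" "w \<le> L + U" for v w
    proof -
      have "ln v - ln w = ln (v / w)" using that assms by (simp add: ln_div)
      also have "\<dots> \<le> v / w - 1" using that assms by (intro ln_le_minus_one) auto
      also have "\<dots> = (v - w) / w" using that assms by (simp add: field_simps)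
      also have "\<dots> \<le> 1 / L" using that assms by (intro frac_le) auto
      finally show ?thesis .
    qed
    have "\<bar>ln t - ln x\<bar> \<le> 1 / L" using *[of t x] *[of x t] t assms by auto
    hence "\<bar>\<Delta>\<bar> * \<bar>ln t - ln x\<bar> \<le> q"
      unfolding q_def using mult_left_mono[of "\<bar>ln t - ln x\<bar>" "1 / L" "\<bar>\<Delta>\<bar>"] by simp
    hence "\<bar>\<Delta> * ln t - \<Delta> * ln x\<bar> \<le> q"
      by (simp add: abs_mult[symmetric] right_diff_distrib)
    hence "\<Delta> * ln x - q \<le> \<Delta> * ln t" "\<Delta> * ln t \<le> \<Delta> * ln x + q" by linarith+
    thus ?thesis using t assms by (simp add: powr_def exp_add[symmetric])
  qed
  have int: "(\<lambda>t. t powr \<Delta>) integrable_on {L..L + U}"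
    using assms by (intro integrable_continuous_interval continuous_intros) auto
  have "integral {L..L + U} (\<lambda>t. x powr \<Delta> * exp (- q)) \<le> I"
    unfolding I_def using bnd by (intro integral_le int) auto
  hence lo: "U * (x powr \<Delta> * exp (- q)) \<le> I" using \<open>0 < U\<close> by (simp add: mult_ac)
  have "I \<le> integral {L..L + U} (\<lambda>t. x powr \<Delta> * exp q)"
    unfolding I_def using bnd by (intro integral_le int) auto
  hence hi: "I \<le> U * (x powr \<Delta> * exp q)" using \<open>0 < U\<close> by (simp add: mult_ac)
  have px: "0 < U * x powr \<Delta>" using assms by simp
  have "0 < U * (x powr \<Delta> * exp (- q))" using assms by simp
  with lo show I: "I > 0" by linarith
  have "exp (- q) \<le> I / (U * x powr \<Delta>)" "I / (U * x powr \<Delta>) \<le> exp q"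
    using lo hi px by (simp_all add: le_divide_eq divide_le_eq mult_ac)
  hence "- q \<le> ln (I / (U * x powr \<Delta>))" "ln (I / (U * x powr \<Delta>)) \<le> q"
    using I px ln_mono[of "I / (U * x powr \<Delta>)" "exp q"]
    by (simp_all add: ln_ge_iff del: ln_le_cancel_iff)
  thus "\<bar>ln (I / (U * x powr \<Delta>))\<bar> \<le> \<bar>\<Delta>\<bar> / L" unfolding q_def by linarith
qed

section \<open>Reverse iterates of a ladder\<close>

text \<open>
  The inverse of the ladder is meaningful only on the range of \<open>\<phi>\<close>; the intermediate value theorem
  shows that this range contains everything from \<open>\<phi> T0\<close> on.
\<close>

lemma inv_into_half_line:
  fixes \<phi> :: "real \<Rightarrow> real"
  assumes cont: "continuous_on {T0..} \<phi>" and lim: "filterlim \<phi> at_top at_top"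
    and y: "\<phi> T0 \<le> y"
  shows "T0 \<le> inv_into {T0..} \<phi> y" "\<phi> (inv_into {T0..} \<phi> y) = y"
proof -
  obtain N where "\<And>t. t \<ge> N \<Longrightarrow> y \<le> \<phi> t"
    using lim unfolding filterlim_at_top eventually_at_top_linorder by meson
  hence N: "y \<le> \<phi> (max N T0)" by simp
  have "continuous_on {T0..max N T0} \<phi>"
    by (rule continuous_on_subset[OF cont]) auto
  then obtain x where "T0 \<le> x" "\<phi> x = y"
    using IVT'[of \<phi> T0 y "max N T0"] y N by auto
  hence "y \<in> \<phi> ` {T0..}" by auto
  from inv_into_into[OF this] f_inv_into_f[OF this]
  show "T0 \<le> inv_into {T0..} \<phi> y" "\<phi> (inv_into {T0..} \<phi> y) = y" by auto
qed

text \<open>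
  Since \<open>\<phi> t \<le> t\<close>, one application of the inverse moves a point to the right. So the half-line
  \<open>{B..}\<close>, where the comparison with \<open>t\<close> is known, is never left, and the bounds for one step iterate.
\<close>

lemma reverse_iterate_bounds:
  fixes \<phi> :: "real \<Rightarrow> real"
  assumes cont: "continuous_on {T0..} \<phi>" and lim: "filterlim \<phi> at_top at_top"
    and mono: "strict_mono_on {T0..} \<phi>"
    and B: "T0 \<le> B" "\<And>t. B \<le> t \<Longrightarrow> \<phi> t \<le> t \<and> t \<le> 2 * \<phi> t"
    and y: "B \<le> y"
  shows "y \<le> reverse_iterate T0 \<phi> r y \<and> reverse_iterate T0 \<phi> r y \<le> 2 ^ r * y"
proof -
  define \<psi> where "\<psi> = inv_into {T0..} \<phi>"
  have le: "\<phi> T0 \<le> \<phi> B" "\<phi> B \<le> B"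
    using strict_mono_on_leD[OF mono, of T0 B] B by auto
  have step: "z \<le> \<psi> z \<and> \<psi> z \<le> 2 * z" if "B \<le> z" for z
  proof -
    have \<psi>: "T0 \<le> \<psi> z" "\<phi> (\<psi> z) = z"
      using inv_into_half_line[OF cont lim, of z] le that by (auto simp: \<psi>_def)
    \<comment> \<open>\<open>B\<close> lies in the region of comparison, so \<open>\<phi> B \<le> B \<le> z = \<phi> (\<psi> z)\<close>, and \<open>\<phi>\<close> reflects the order.\<close>
    have "B \<le> \<psi> z"
    proof (rule ccontr)
      assume "\<not> B \<le> \<psi> z"
      hence "\<phi> (\<psi> z) < \<phi> B" using \<psi> B by (intro strict_mono_onD[OF mono]) auto
      thus False using \<psi> le that by linarith
    qed
    thus ?thesis using B(2)[of "\<psi> z"] \<psi> by simp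
  qed
  have "y \<le> (\<psi> ^^ r) y \<and> (\<psi> ^^ r) y \<le> 2 ^ r * y"
  proof (induction r)
    case (Suc r)
    then show ?case using step[of "(\<psi> ^^ r) y"] y by auto
  qed simp
  thus ?thesis by (simp add: reverse_iterate_def \<psi>_def)
qed

text \<open>
  Locates the points associated with an interval: a forward step \<open>\<phi>\<close> undoes the last inverse step
  at both ends of the interval and preserves the strict order. The lower bounds on the reverse
  iterates keep every inverse step inside the range of \<open>\<phi>\<close>.
\<close>

lemma iterate_between_reverse_iterates:
  fixes \<phi> :: "real \<Rightarrow> real"
  assumes cont: "continuous_on {T0..} \<phi>" and lim: "filterlim \<phi> at_top at_top"
    and mono: "strict_mono_on {T0..} \<phi>"
    and big: "\<And>r. \<phi> T0 \<le> reverse_iterate T0 \<phi> r y" "\<And>r. \<phi> T0 \<le> reverse_iterate T0 \<phi> r z"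
    and d: "d \<in> {reverse_iterate T0 \<phi> k y <..< reverse_iterate T0 \<phi> k z}"
    and r: "r \<le> k"
  shows "(\<phi> ^^ (k - r)) d \<in> {reverse_iterate T0 \<phi> r y <..< reverse_iterate T0 \<phi> r z}"
  using r
proof (induction r rule: inc_induct)
  case base
  then show ?case using d by simp
next
  case (step r)
  define \<psi> where "\<psi> = inv_into {T0..} \<phi>"
  define x where "x = (\<phi> ^^ (k - Suc r)) d"
  define y' where "y' = reverse_iterate T0 \<phi> r y"
  define z' where "z' = reverse_iterate T0 \<phi> r z"
  have x: "\<psi> y' < x" "x < \<psi> z'"
    using step.IH by (auto simp: x_def y'_def z'_def \<psi>_def reverse_iterate_def)
  have y': "T0 \<le> \<psi> y'" "\<phi> (\<psi> y') = y'" and z': "T0 \<le> \<psi> z'" "\<phi> (\<psi> z') = z'"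
    using inv_into_half_line[OF cont lim] big[of r] by (auto simp: \<psi>_def y'_def z'_def)
  have "\<phi> (\<psi> y') < \<phi> x" "\<phi> x < \<phi> (\<psi> z')"
    using x y'(1) z'(1) by (intro strict_mono_onD[OF mono]; simp)+
  hence "\<phi> x \<in> {y'<..<z'}" using y' z' by simp
  moreover have "(\<phi> ^^ (k - r)) d = \<phi> x"
    using step.hyps by (simp add: x_def Suc_diff_Suc[symmetric])
  ultimately show ?case by (simp add: y'_def z'_def)
qed

text \<open>
  Since \<open>0 < 1 - euler_mascheroni < 1\<close>, the defect \<open>t - \<phi> t\<close> is eventually positive and at most
  \<open>2 t / ln t\<close>, which drops below \<open>t / 2\<close> once \<open>ln t > 4\<close>.
\<close>

lemma eventually_ladder_comparable:
  fixes \<phi> :: "real \<Rightarrow> real"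
  assumes "(\<lambda>t. t - \<phi> t) \<sim>[at_top] (\<lambda>t. (1 - euler_mascheroni) * (t / ln t))"
  shows "\<forall>\<^sub>F t in at_top. \<phi> t \<le> t \<and> t \<le> 2 * \<phi> t"
proof -
  define c :: real where "c = 1 - euler_mascheroni"
  have c: "0 < c" "c < 1"
    using euler_mascheroni_less_13_over_22 euler_mascheroni_pos by (auto simp: c_def)
  have "((\<lambda>t. (t - \<phi> t) / (c * (t / ln t))) \<longlongrightarrow> 1) at_top"
    using assms unfolding c_def by (rule asymp_equivD_strong)
      (use c in \<open>auto simp: c_def intro!: eventually_mono[OF eventually_gt_at_top[of 1]]\<close>)
  hence "\<forall>\<^sub>F t in at_top. (t - \<phi> t) / (c * (t / ln t)) \<in> {0<..<2}"
    by (intro topological_tendstoD) auto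
  moreover have "\<forall>\<^sub>F t :: real in at_top. 4 < ln t \<and> 1 < t"
    by (intro eventually_conj eventually_gt_at_top
          filterlim_at_top_dense[THEN iffD1, OF ln_at_top, rule_format])
  ultimately show ?thesis
  proof eventually_elim
    case (elim t)
    define D where "D = c * (t / ln t)"
    have D: "0 < D" using elim c by (simp add: D_def)
    have "0 < t - \<phi> t" "t - \<phi> t < 2 * D"
      using elim D unfolding D_def[symmetric] by (auto simp: zero_less_divide_iff divide_less_eq)
    moreover have "D \<le> 1 * (t / 4)"
      unfolding D_def using elim c by (intro mult_mono frac_le) auto
    ultimately show ?case by linarith
  qed
qed

section \<open>The transformation of a power signal\<close>

theorem mainTheorem2:
  fixes \<mu> \<phi>1 :: "real \<Rightarrow> real" and y0 T0 \<Delta> :: real and k0 :: nat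
  assumes "jacobs_ladder y0 \<mu> T0 \<phi>1"
    and "\<forall>t\<ge>T0. \<phi>1 differentiable (at t)"
    and "continuous_on {T0..} (Ztilde_sq \<phi>1)"
    and "strict_mono_on {T0..} \<phi>1"
    and "filterlim \<phi>1 at_top at_top"
    and "(\<lambda>t. t - \<phi>1 t) \<sim>[at_top] (\<lambda>t. (1 - euler_mascheroni) * (t / ln t))"
    and "\<exists>\<epsilon> \<in> O[at_top](\<lambda>t. ln (ln t) / ln t). \<forall>\<^sub>F t in at_top.
           Ztilde_sq \<phi>1 t = (cmod (zeta_crit t))\<^sup>2 / ((1 + \<epsilon> t) * ln t)"
    and "\<Delta> \<noteq> 0"
  shows "\<exists>C>0. \<forall>k (a :: nat \<Rightarrow> real).
           1 \<le> k \<longrightarrow> k \<le> k0 \<longrightarrow> (\<forall>L. 0 < a L \<and> a L \<le> 1 / 2) \<longrightarrow>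
           (\<exists>L0>0. \<forall>L::nat. real L > L0 \<longrightarrow> (\<forall>U. 0 < U \<and> U < a L \<longrightarrow>
              (\<forall>\<alpha> \<beta>. associated_points T0 \<phi>1 (real L) U k (\<lambda>t. t powr \<Delta>) \<alpha> \<longrightarrow>
                     associated_points_unit T0 \<phi>1 (real L) U k \<beta> \<longrightarrow>
                 \<alpha> 0 \<in> {real L <..< real L + U} \<and>
                 \<bar>(\<Prod>r=1..k. (cmod (zeta_crit (\<alpha> r) / zeta_crit (\<beta> r)))\<^sup>2) - 1\<bar>
                   \<le> C * (ln (ln (real L)) / ln (real L)))))"
proof -
  define \<delta> :: "real \<Rightarrow> real" where "\<delta> = (\<lambda>t. ln (ln t) / ln t)"
  obtain \<epsilon> where \<epsilon>O: "\<epsilon> \<in> O[at_top](\<delta>)"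
    and \<epsilon>Z: "\<forall>\<^sub>F t in at_top. Ztilde_sq \<phi>1 t = (cmod (zeta_crit t))\<^sup>2 / ((1 + \<epsilon> t) * ln t)"
    using assms(7) unfolding \<delta>_def by blast
  obtain K where K: "K > 0" "\<forall>\<^sub>F t in at_top. norm (\<epsilon> t) \<le> K * norm (\<delta> t)"
    using \<epsilon>O by (rule landau_o.bigE)
  have cont: "continuous_on {T0..} \<phi>1"
    using assms(2) by (intro continuous_at_imp_continuous_on ballI)
      (auto intro: differentiable_imp_continuous_within)
  note lim = assms(5) and mono = assms(4)

  \<comment> \<open>\<open>b L\<close> bounds the points: \<open>k0\<close> doublings and \<open>L + U \<le> 2 L\<close>. \<open>c\<close> is the cost of one quotient of
    values of \<open>G\<close>: \<open>2 K\<close> for each of the two factors \<open>1 + \<epsilon>\<close>, and \<open>ln b\<close> for the logarithms.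
    \<open>M\<close> is the total cost, all in units of \<open>\<delta> L\<close>.\<close>
  define b :: real where "b = 2 ^ (k0 + 1)"
  define c where "c = 4 * K + ln b"
  define M where "M = real k0 * c + \<bar>\<Delta>\<bar>"
  have b: "1 \<le> b" unfolding b_def by (rule one_le_power) simp
  have c: "0 \<le> c" using K b by (simp add: c_def)
  have M: "0 < M" using c assms(8) by (simp add: M_def add_nonneg_pos)

  have "((\<lambda>x. ln x / x) \<longlongrightarrow> 0) (at_top :: real filter)"
    by (rule ln_x_over_x_tendsto_0)
  hence "(\<delta> \<longlongrightarrow> 0) at_top"
    unfolding \<delta>_def by (rule filterlim_compose[OF _ ln_at_top])
  hence \<delta>0: "\<forall>\<^sub>F t in at_top. \<delta> t < 1 / (2 * (K + M + 1))"
    using K M by (intro order_tendstoD) auto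
  have ln_big: "\<forall>\<^sub>F t :: real in at_top. exp 1 < ln t"
    by (rule filterlim_at_top_dense[THEN iffD1, OF ln_at_top, rule_format])

  \<comment> \<open>\<open>exp 1 < ln t\<close> puts \<open>ln t\<close> where \<open>ln u / u\<close> decreases, so that \<open>\<delta>\<close> is decreasing, and yields
    \<open>ln (ln t) \<ge> 1\<close>, so that \<open>1 / ln t \<le> \<delta> t\<close>. The bound on \<open>\<delta> t\<close> makes both \<open>K * \<delta> t\<close> and \<open>M * \<delta> t\<close>
    at most \<open>1 / 2\<close>.\<close>
  have "\<forall>\<^sub>F t in at_top. T0 \<le> t \<and> 1 \<le> t \<and> exp 1 < ln t \<and> \<delta> t < 1 / (2 * (K + M + 1))
      \<and> norm (\<epsilon> t) \<le> K * norm (\<delta> t) \<and> \<phi>1 t \<le> t \<and> t \<le> 2 * \<phi>1 t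
      \<and> Ztilde_sq \<phi>1 t = (cmod (zeta_crit t))\<^sup>2 / ((1 + \<epsilon> t) * ln t)"
    using eventually_ge_at_top[of T0] eventually_ge_at_top[of 1] ln_big \<delta>0 K(2)
      eventually_ladder_comparable[OF assms(6)] \<epsilon>Z
    by eventually_elim auto
  then obtain B where B: "\<And>t. B \<le> t \<Longrightarrow> T0 \<le> t \<and> 1 \<le> t \<and> exp 1 < ln t \<and> \<delta> t < 1 / (2 * (K + M + 1))
      \<and> norm (\<epsilon> t) \<le> K * norm (\<delta> t) \<and> \<phi>1 t \<le> t \<and> t \<le> 2 * \<phi>1 t
      \<and> Ztilde_sq \<phi>1 t = (cmod (zeta_crit t))\<^sup>2 / ((1 + \<epsilon> t) * ln t)"
    unfolding eventually_at_top_linorder by blast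
  have B1: "1 \<le> B" using B[of B] by simp

  define G where "G = (\<lambda>t. (1 + \<epsilon> t) * ln t)"
  have exp1: "(1::real) < exp 1" by simp
  have at: "0 < 1 + \<epsilon> t" "0 < ln t" "0 < G t"
      "(cmod (zeta_crit t))\<^sup>2 = Ztilde_sq \<phi>1 t * G t" "\<bar>ln (1 + \<epsilon> t)\<bar> \<le> 2 * K * \<delta> t"
      "1 / ln t \<le> \<delta> t" if t: "B \<le> t" for t
  proof -
    have ln: "1 < ln t" using B[OF t] exp1 by linarith
    have \<delta>: "0 \<le> \<delta> t" using ln by (simp add: \<delta>_def)
    have "K * \<delta> t \<le> K * (1 / (2 * (K + M + 1)))" using B[OF t] K by (intro mult_left_mono) auto
    also have "\<dots> \<le> 1 / 2" using K M by (simp add: field_simps)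
    finally have half: "K * \<delta> t \<le> 1 / 2" .
    have \<epsilon>: "\<bar>\<epsilon> t\<bar> \<le> K * \<delta> t" using B[OF t] \<delta> by simp
    show *: "0 < 1 + \<epsilon> t" "0 < ln t" using \<epsilon> half ln by auto
    show G: "0 < G t" using * by (simp add: G_def)
    have Z: "Ztilde_sq \<phi>1 t = (cmod (zeta_crit t))\<^sup>2 / G t" using B[OF t] by (simp add: G_def)
    show "(cmod (zeta_crit t))\<^sup>2 = Ztilde_sq \<phi>1 t * G t"
      using Z G by simp
    show "\<bar>ln (1 + \<epsilon> t)\<bar> \<le> 2 * K * \<delta> t"
      using abs_ln_one_plus_le[of "\<epsilon> t"] \<epsilon> half by linarith
    have "exp 1 \<le> ln t" using B[OF t] by linarith
    hence "1 \<le> ln (ln t)" using *(2) by (subst ln_ge_iff)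
    thus "1 / ln t \<le> \<delta> t" unfolding \<delta>_def using ln by (intro divide_right_mono) auto
  qed
  have G_ratio: "\<bar>ln (G x / G y)\<bar> \<le> c * \<delta> L"
    if L: "B \<le> L" and x: "L \<le> x" "x \<le> b * L" and y: "L \<le> y" "y \<le> b * L" for x y L
  proof -
    have \<delta>_anti: "\<delta> z \<le> \<delta> L" if "L \<le> z" for z
      unfolding \<delta>_def using B[OF L] B1 L that by (intro ln_x_over_x_mono) auto
    have ln1: "1 < L" using B[OF L] exp1 B1 L by (smt (verit) ln_one)
    have "ln b / ln L \<le> ln b * \<delta> L"
      using mult_left_mono[OF at(6)[OF L], of "ln b"] b by simp
    hence "\<bar>ln (ln x) - ln (ln y)\<bar> \<le> ln b * \<delta> L"
      using abs_ln_ln_diff_le[OF ln1 x y b] by linarith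
    moreover have "\<bar>ln (1 + \<epsilon> z)\<bar> \<le> 2 * K * \<delta> L" if "L \<le> z" for z
      using at(5)[of z] \<delta>_anti[OF that] L that K
      by (smt (verit, best) mult_left_mono)
    from this[OF x(1)] this[OF y(1)] have "\<bar>ln (1 + \<epsilon> x)\<bar> + \<bar>ln (1 + \<epsilon> y)\<bar> \<le> 4 * K * \<delta> L" by simp
    moreover have "ln (G x / G y) = (ln (1 + \<epsilon> x) - ln (1 + \<epsilon> y)) + (ln (ln x) - ln (ln y))"
      using at[of x] at[of y] x y L by (simp add: G_def ln_div ln_mult)
    ultimately show ?thesis unfolding c_def ring_distribs by linarith
  qed

  have main: "\<alpha> 0 \<in> {L <..< L + U} \<and>
      \<bar>(\<Prod>r=1..k. (cmod (zeta_crit (\<alpha> r) / zeta_crit (\<beta> r)))\<^sup>2) - 1\<bar> \<le> 2 * (M * \<delta> L)"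
    if k: "k \<le> k0" and L: "B \<le> L" and U: "0 < U" "U < 1"
      and \<alpha>: "associated_points T0 \<phi>1 L U k (\<lambda>t. t powr \<Delta>) \<alpha>"
      and \<beta>: "associated_points_unit T0 \<phi>1 L U k \<beta>" for k L U \<alpha> \<beta>
  proof -
    define R where "R = reverse_iterate T0 \<phi>1"
    define H where "H = R k (L + U) - R k L"
    obtain d where d: "d \<in> {R k L <..< R k (L + U)}"
      and \<alpha>d: "\<And>r. r \<le> k \<Longrightarrow> \<alpha> r = (\<phi>1 ^^ (k - r)) d"
      and \<alpha>I: "integral {L..L + U} (\<lambda>t. t powr \<Delta>)
                = H * \<alpha> 0 powr \<Delta> * (\<Prod>r=1..k. Ztilde_sq \<phi>1 (\<alpha> r))"
      using \<alpha> unfolding associated_points_def R_def H_def by auto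
    obtain e where e: "e \<in> {R k L <..< R k (L + U)}"
      and \<beta>e: "\<And>r. 1 \<le> r \<Longrightarrow> r \<le> k \<Longrightarrow> \<beta> r = (\<phi>1 ^^ (k - r)) e"
      and \<beta>I: "U = H * (\<Prod>r=1..k. Ztilde_sq \<phi>1 (\<beta> r))"
      using \<beta> unfolding associated_points_unit_def R_def H_def by auto
    have H: "0 < H" using d by (simp add: H_def)
    have T0B: "T0 \<le> B" using B by blast
    have R: "y \<le> R r y" "R r y \<le> 2 ^ r * y" if "B \<le> y" for r y
      unfolding R_def
      using reverse_iterate_bounds[OF cont lim mono T0B _ that, of r] B by auto
    have "\<phi>1 T0 \<le> \<phi>1 B" "\<phi>1 B \<le> B"
      using strict_mono_on_leD[OF mono, of T0 B] T0B B[of B] by auto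
    hence big: "\<phi>1 T0 \<le> R r L" "\<phi>1 T0 \<le> R r (L + U)" for r
      using R(1)[of L r] R(1)[of "L + U" r] L U by linarith+
    note between = iterate_between_reverse_iterates[OF cont lim mono big[unfolded R_def], folded R_def]
    have range: "L \<le> x" "x \<le> b * L" if "x \<in> {R r L <..< R r (L + U)}" "r \<le> k" for x r
    proof -
      show "L \<le> x" using that R(1)[OF L, of r] by simp
      have "x \<le> 2 ^ r * (L + U)" using that R(2)[of "L + U" r] L U by simp
      also have "\<dots> \<le> 2 ^ k0 * (2 * L)"
        using that k L U B1 by (intro mult_mono power_increasing) auto
      finally show "x \<le> b * L" by (simp add: b_def)
    qed
    have \<alpha>_in: "L \<le> \<alpha> r" "\<alpha> r \<le> b * L" if "r \<le> k" for r
      using range[OF between[OF d that] that] \<alpha>d[OF that] by simp_all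
    have \<beta>_in: "L \<le> \<beta> r" "\<beta> r \<le> b * L" if "1 \<le> r" "r \<le> k" for r
      using range[OF between[OF e that(2)] that(2)] \<beta>e[OF that] by simp_all
    have \<alpha>0: "\<alpha> 0 \<in> {L <..< L + U}"
      using between[OF d, of 0] \<alpha>d[of 0] by (simp add: R_def reverse_iterate_def)

    define PA where "PA = (\<Prod>r=1..k. Ztilde_sq \<phi>1 (\<alpha> r))"
    define PB where "PB = (\<Prod>r=1..k. Ztilde_sq \<phi>1 (\<beta> r))"
    define PG where "PG = (\<Prod>r=1..k. G (\<alpha> r) / G (\<beta> r))"
    have L1: "1 \<le> L" using L B1 by simp
    have mean: "0 < H * \<alpha> 0 powr \<Delta> * PA" "\<bar>ln (H * \<alpha> 0 powr \<Delta> * PA / (U * \<alpha> 0 powr \<Delta>))\<bar> \<le> \<bar>\<Delta>\<bar> / L"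
      using abs_ln_mean_powr_le[of L U "\<alpha> 0" \<Delta>] L1 U \<alpha>0 unfolding \<alpha>I[folded PA_def] by auto
    \<comment> \<open>The derivative vanishes at zeros of \<open>zeta_crit\<close>, so the positivity of the two products, and with it
      that no \<open>\<beta> r\<close> is a zero, is read off from the identities, whose left-hand sides are positive.\<close>
    have "0 < H * \<alpha> 0 powr \<Delta>" using H \<alpha>0 L1 by simp
    with mean(1) have PA: "0 < PA" by (rule zero_less_mult_pos)
    have PB: "0 < PB" using \<beta>I[folded PB_def] H U by (metis zero_less_mult_pos)
    \<comment> \<open>The length \<open>H\<close> of the reverse interval cancels.\<close>
    have "H * \<alpha> 0 powr \<Delta> * PA / (U * \<alpha> 0 powr \<Delta>) = PA / PB"
      using H PB \<alpha>0 L1 by (subst \<beta>I[folded PB_def]) (simp add: field_simps)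
    hence ln1: "\<bar>ln (PA / PB)\<bar> \<le> \<bar>\<Delta>\<bar> / L" using mean(2) by simp
    have pos: "0 < G (\<alpha> r) / G (\<beta> r)" if "r \<in> {1..k}" for r
      using at(3)[of "\<alpha> r"] at(3)[of "\<beta> r"] \<alpha>_in[of r] \<beta>_in[of r] that L by simp
    have PG: "0 < PG" unfolding PG_def by (intro prod_pos) (use pos in auto)
    have "\<bar>ln PG\<bar> \<le> card {1..k} * (c * \<delta> L)"
      unfolding PG_def using pos \<alpha>_in \<beta>_in L by (intro abs_ln_prod_le G_ratio) auto
    moreover have "0 \<le> 1 / ln L" using at(2)[OF L] by simp
    hence \<delta>pos: "0 \<le> \<delta> L" using at(6)[OF L] by linarith
    moreover have "real k * (c * \<delta> L) \<le> real k0 * (c * \<delta> L)"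
      using k c \<delta>pos by (intro mult_right_mono) auto
    ultimately have ln2: "\<bar>ln PG\<bar> \<le> real k0 * (c * \<delta> L)" by simp
    have "1 / L \<le> 1 / ln L" using at(2)[OF L] L1 ln_bound[of L] by (intro divide_left_mono) auto
    also have "\<dots> \<le> \<delta> L" by (rule at(6)[OF L])
    finally have "\<bar>\<Delta>\<bar> / L \<le> \<bar>\<Delta>\<bar> * \<delta> L" using mult_left_mono[of "1 / L" "\<delta> L" "\<bar>\<Delta>\<bar>"] by simp
    moreover have "ln (PA / PB * PG) = ln (PA / PB) + ln PG"
      using PA PB PG by (intro ln_mult_pos) auto
    moreover have "M * \<delta> L = real k0 * (c * \<delta> L) + \<bar>\<Delta>\<bar> * \<delta> L"
      by (simp add: M_def ring_distribs mult.assoc)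
    ultimately have lnP: "\<bar>ln (PA / PB * PG)\<bar> \<le> M * \<delta> L" using ln1 ln2 by linarith
    have "(\<Prod>r=1..k. (cmod (zeta_crit (\<alpha> r) / zeta_crit (\<beta> r)))\<^sup>2)
        = (\<Prod>r=1..k. (Ztilde_sq \<phi>1 (\<alpha> r) / Ztilde_sq \<phi>1 (\<beta> r)) * (G (\<alpha> r) / G (\<beta> r)))"
    proof (rule prod.cong)
      fix r assume "r \<in> {1..k}"
      hence "B \<le> \<alpha> r" "B \<le> \<beta> r" using \<alpha>_in[of r] \<beta>_in[of r] L by auto
      thus "(cmod (zeta_crit (\<alpha> r) / zeta_crit (\<beta> r)))\<^sup>2
          = (Ztilde_sq \<phi>1 (\<alpha> r) / Ztilde_sq \<phi>1 (\<beta> r)) * (G (\<alpha> r) / G (\<beta> r))"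
        by (simp add: norm_divide power_divide at(4))
    qed simp
    also have "\<dots> = PA / PB * PG"
      by (simp add: PA_def PB_def PG_def prod.distrib prod_dividef)
    finally have prod: "(\<Prod>r=1..k. (cmod (zeta_crit (\<alpha> r) / zeta_crit (\<beta> r)))\<^sup>2) = PA / PB * PG" .
    have "M * \<delta> L \<le> M * (1 / (2 * (K + M + 1)))" using B[OF L] M by (intro mult_left_mono) auto
    also have "\<dots> \<le> 1 / 2" using K M by (simp add: field_simps)
    finally have half: "M * \<delta> L \<le> 1 / 2" .
    have "\<bar>PA / PB * PG - 1\<bar> \<le> 2 * (M * \<delta> L)"
      using PA PB PG by (intro abs_minus_one_le_of_abs_ln_le lnP half) simp
    thus ?thesis using \<alpha>0 prod by simp
  qed

  \<comment> \<open>Neither \<open>M\<close> nor \<open>B\<close> depends on \<open>k\<close> or \<open>a\<close>.\<close>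
  show ?thesis
  proof (rule exI[of _ "2 * M"], rule conjI, goal_cases)
    case 1
    show ?case using M by simp
  next
    case 2
    show ?case
    proof (intro allI impI)
      fix k and a :: "nat \<Rightarrow> real"
      assume k: "1 \<le> k" "k \<le> k0" and a: "\<forall>L. 0 < a L \<and> a L \<le> 1 / 2"
      show "\<exists>L0>0. \<forall>L::nat. real L > L0 \<longrightarrow> (\<forall>U. 0 < U \<and> U < a L \<longrightarrow>
                (\<forall>\<alpha> \<beta>. associated_points T0 \<phi>1 (real L) U k (\<lambda>t. t powr \<Delta>) \<alpha> \<longrightarrow>
                       associated_points_unit T0 \<phi>1 (real L) U k \<beta> \<longrightarrow>
                   \<alpha> 0 \<in> {real L <..< real L + U} \<and>
                   \<bar>(\<Prod>r=1..k. (cmod (zeta_crit (\<alpha> r) / zeta_crit (\<beta> r)))\<^sup>2) - 1\<bar>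
                     \<le> 2 * M * (ln (ln (real L)) / ln (real L))))"
      proof (rule exI[of _ B], rule conjI, goal_cases)
        case 1
        show ?case using B1 by simp
      next
        case 2
        show ?case
        proof (intro allI impI)
          fix L :: nat and U \<alpha> \<beta>
          assume L: "B < real L" and U: "0 < U \<and> U < a L"
            and as: "associated_points T0 \<phi>1 (real L) U k (\<lambda>t. t powr \<Delta>) \<alpha>"
              "associated_points_unit T0 \<phi>1 (real L) U k \<beta>"
          have "U < 1" using U a[rule_format, of L] by linarith
          thus "\<alpha> 0 \<in> {real L <..< real L + U} \<and>
              \<bar>(\<Prod>r=1..k. (cmod (zeta_crit (\<alpha> r) / zeta_crit (\<beta> r)))\<^sup>2) - 1\<bar>
                \<le> 2 * M * (ln (ln (real L)) / ln (real L))"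
            using main[OF k(2) _ _ _ as] L U by (auto simp: \<delta>_def mult.assoc)
        qed
      qed
    qed
  qed
qed

end
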